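(* Let $m=p_1p_2\cdots p_k$ with $p_1,\dots,p_k$ distinct primes. Then the cyclotomic polytope $\mathcal{C}_m$ and the transportation polytope $P(p_1,\dots,p_k)$ are dual to each other, i.e. the face lattice of one is isomorphic to the face lattice of the other with the order reversed.
   Context: For $p$ prime, $\mathcal{C}_p=\operatorname{conv}(e_1,\dots,e_{p-1},-\sum_ie_i)\subset\mathbb{R}^{p-1}$, and for squarefree $m=p_1\cdots p_k$, $\mathcal{C}_m=\operatorname{conv}(v_1\otimes\cdots\otimes v_k : v_i \text{ a vertex of }\mathcal{C}_{p_i})\subset\mathbb{R}^{p_1-1}\otimes\cdots\otimes\mathbb{R}^{p_k-1}$. For positive integers $p_1,\dots,p_k$, $P(p_1,\dots,p_k)$ is the set of real $p_1\times\cdots\times p_k$ arrays $\mathbf{x}=(x_{i_1\ldots i_k})$ with nonnegative entries such that for each $i\in\{1,\dots,k\}$ and each choice of the other indices $(i_1,\dots,\widehat{i_i},\dots,i_k)$, the line sum $\sum_{j=1}^{p_i}x_{i_1\ldots i_{i-1}\,j\,i_{i+1}\ldots i_k}$ equals $p_i$. *)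

theory Defs
  imports "HOL-Analysis.Analysis" "HOL-Analysis.Finite_Function_Topology"
begin

text \<open>
  The dimensions \<open>p\<^sub>i\<close> are data, so the spaces \<open>\<real>\<^sup>n\<close> cannot be types here. A vector of \<open>\<real>\<^sup>n\<close> is a
  finitely supported function \<^typ>\<open>nat \<Rightarrow>\<^sub>0 real\<close> vanishing outside \<open>{..<n}\<close>; an element of
  \<open>\<real>\<^bsup>n\<^sub>1\<^esup> \<otimes> \<cdots> \<otimes> \<real>\<^bsup>n\<^sub>k\<^esup>\<close>, identified with an \<open>n\<^sub>1 \<times> \<cdots> \<times> n\<^sub>k\<close> array via the basis of the
  \<open>e\<^bsub>j\<^sub>1\<^esub> \<otimes> \<cdots> \<otimes> e\<^bsub>j\<^sub>k\<^esub>\<close>, is a \<^typ>\<open>nat list \<Rightarrow>\<^sub>0 real\<close> supported on multi-indices \<open>[j\<^sub>1, \<dots>, j\<^sub>k]\<close> with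
  \<open>j\<^sub>i < n\<^sub>i\<close>. Indices start at 0.
\<close>

definition multi_indices :: "nat list \<Rightarrow> nat list set" where
  "multi_indices ns = {js. length js = length ns \<and> (\<forall>i<length ns. js ! i < ns ! i)}"

abbreviation unit_vec :: "nat \<Rightarrow> (nat \<Rightarrow>\<^sub>0 real)" where
  "unit_vec j \<equiv> Poly_Mapping.single j 1"

definition prime_cyclotomic_polytope :: "nat \<Rightarrow> (nat \<Rightarrow>\<^sub>0 real) set" where
  "prime_cyclotomic_polytope p =
     convex hull (insert (- (\<Sum>j<p - 1. unit_vec j)) (unit_vec ` {..<p - 1}))"

lift_definition tensor :: "(nat \<Rightarrow>\<^sub>0 real) list \<Rightarrow> (nat list \<Rightarrow>\<^sub>0 real)" is
  "\<lambda>vs js. if length js = length vs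
            then \<Prod>i<length vs. Poly_Mapping.lookup (vs ! i) (js ! i) else 0"
proof -
  fix vs :: "(nat \<Rightarrow>\<^sub>0 real) list"
  let ?K = "\<Union>v\<in>set vs. Poly_Mapping.keys v"
  let ?f = "\<lambda>js. if length js = length vs
                  then \<Prod>i<length vs. Poly_Mapping.lookup (vs ! i) (js ! i) else 0"
  have "{js. ?f js \<noteq> 0} \<subseteq> {js. set js \<subseteq> ?K \<and> length js = length vs}"
  proof
    fix js assume "js \<in> {js. ?f js \<noteq> 0}"
    then have nz: "?f js \<noteq> 0" by simp
    then have len: "length js = length vs" by (meson)
    have "(\<Prod>i<length vs. Poly_Mapping.lookup (vs ! i) (js ! i)) \<noteq> 0"
      using nz len by simp
    then have "js ! i \<in> Poly_Mapping.keys (vs ! i)" if "i < length vs" for i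
      using that by (simp add: in_keys_iff)
    then have "set js \<subseteq> ?K"
      using len by (metis (no_types, lifting) UN_I in_set_conv_nth nth_mem subsetI)
    with len show "js \<in> {js. set js \<subseteq> ?K \<and> length js = length vs}" by simp
  qed
  moreover have "finite {js. set js \<subseteq> ?K \<and> length js = length vs}"
    by (intro finite_lists_length_eq) auto
  ultimately show "finite {js. ?f js \<noteq> 0}"
    by (rule finite_subset)
qed

text \<open>
  The polytope \<open>\<C>\<^sub>m\<close> for \<open>m = p\<^sub>1 \<cdots> p\<^sub>k\<close>, given by its list of prime factors, which fixes the
  order of the tensor factors.
\<close>

definition cyclotomic_polytope :: "nat list \<Rightarrow> (nat list \<Rightarrow>\<^sub>0 real) set" where
  "cyclotomic_polytope ps =
     convex hull {tensor vs | vs. length vs = length ps \<and>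
       (\<forall>i<length ps. (vs ! i) extreme_point_of prime_cyclotomic_polytope (ps ! i))}"

text \<open>
  The line in direction \<open>i\<close> through \<open>js\<close> does not depend on the entry \<open>js ! i\<close>, so quantifying over
  all multi-indices \<open>js\<close> ranges over all choices of the other indices.
\<close>

definition transportation_polytope :: "nat list \<Rightarrow> (nat list \<Rightarrow>\<^sub>0 real) set" where
  "transportation_polytope ps =
     {x. Poly_Mapping.keys x \<subseteq> multi_indices ps \<and>
         (\<forall>js\<in>multi_indices ps. 0 \<le> Poly_Mapping.lookup x js) \<and>
         (\<forall>i<length ps. \<forall>js\<in>multi_indices ps.
            (\<Sum>j<ps ! i. Poly_Mapping.lookup x (js[i := j])) = real (ps ! i))}"

text \<open>
  The face lattice of \<open>S\<close> is the set of all its faces, \<open>{}\<close> and \<open>S\<close> included, ordered by inclusion.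
\<close>

definition dual_polytopes :: "'a::real_vector set \<Rightarrow> 'b::real_vector set \<Rightarrow> bool" where
  "dual_polytopes S T \<longleftrightarrow>
     (\<exists>\<phi>. bij_betw \<phi> {F. F face_of S} {G. G face_of T} \<and>
          (\<forall>F F'. F face_of S \<longrightarrow> F' face_of S \<longrightarrow> (F \<subseteq> F' \<longleftrightarrow> \<phi> F' \<subseteq> \<phi> F)))"

end

theory Submission
  imports Defs
begin

text \<open>
  The multi-indices label both the vertices \<open>v\<^sub>J\<close> of the cyclotomic polytope and the facet inequalities
  \<open>x\<^sub>J \<ge> 0\<close> of the transportation polytope. Since the vertices of each tensor factor sum to zero,
  \<open>J \<mapsto> f v\<^sub>J\<close> has zero line sums for every linear functional \<open>f\<close>, and every array with zero line
  sums arises in this way. Hence \<open>x\<^sub>J = 1 + f v\<^sub>J\<close> identifies the transportation polytope with the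
  functionals that are at least \<open>-1\<close> on all \<open>v\<^sub>J\<close>, i.e. up to sign with the polar of the cyclotomic
  polytope. A face \<open>F\<close> corresponds to the face cut out by \<open>x\<^sub>J = 0\<close> for all \<open>v\<^sub>J \<in> F\<close>; that every
  face is recovered from its image is the exposedness of faces, which follows from Farkas' lemma.
\<close>

subsection \<open>Farkas' lemma and exposed faces\<close>

text \<open>Induction on the generators, so that no topology on the vector space is needed. If the
  functional found for \<open>I\<close> is negative on the new generator, everything is projected
  along that generator and the induction hypothesis is applied to the images.\<close>

lemma farkas:
  fixes v :: "'i \<Rightarrow> 'a::real_vector"
  assumes "finite I"
  shows "(\<exists>u. (\<forall>i\<in>I. 0 \<le> u i) \<and> c = (\<Sum>i\<in>I. u i *\<^sub>R v i)) \<or>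
         (\<exists>f::'a \<Rightarrow> real. linear f \<and> (\<forall>i\<in>I. 0 \<le> f (v i)) \<and> f c < 0)"
  using assms
proof (induction I arbitrary: v c rule: finite_induct)
  case empty
  show ?case
  proof (cases "c = 0")
    case False
    then have "independent {c}" by simp
    then obtain f :: "'a \<Rightarrow> real" where "linear f" "f c = -1"
      using linear_independent_extend[of "{c}" "\<lambda>_. -1::real"] by auto
    then show ?thesis by auto
  qed auto
next
  case (insert n I)
  consider (cone) u where "\<forall>i\<in>I. 0 \<le> u i" "c = (\<Sum>i\<in>I. u i *\<^sub>R v i)"
    | (sep) f :: "'a \<Rightarrow> real" where "linear f" "\<forall>i\<in>I. 0 \<le> f (v i)" "f c < 0"
    using insert.IH[of c v] by blast
  then show ?case
  proof cases
    case cone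
    have "(\<Sum>i\<in>I. (u(n := 0)) i *\<^sub>R v i) = (\<Sum>i\<in>I. u i *\<^sub>R v i)"
      by (rule sum.cong) (use insert.hyps in auto)
    with cone have "\<exists>u. (\<forall>i\<in>insert n I. 0 \<le> u i) \<and> c = (\<Sum>i\<in>insert n I. u i *\<^sub>R v i)"
      using insert.hyps by (intro exI[of _ "u(n := 0)"]) auto
    then show ?thesis ..
  next
    case sep
    show ?thesis
    proof (cases "f (v n) \<ge> 0")
      case True
      with sep show ?thesis by auto
    next
      case False
      define g where "g = (\<lambda>x. f x / - f (v n))"
      have lg: "linear g" 
        using sep(1) unfolding g_def linear_iff by (simp add: add_divide_distrib)
      have g: "\<forall>i\<in>I. 0 \<le> g (v i)" "g c < 0" "g (v n) = -1"
        using sep False by (auto simp: g_def field_simps)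
      \<comment> \<open>projection along \<open>v n\<close> onto the kernel of \<open>g\<close>\<close>
      define \<pi> where "\<pi> = (\<lambda>x. x + g x *\<^sub>R v n)"
      have l\<pi>: "linear \<pi>"
        using lg unfolding \<pi>_def linear_iff by (simp add: algebra_simps)
      consider (cone) u where "\<forall>i\<in>I. 0 \<le> u i" "\<pi> c = (\<Sum>i\<in>I. u i *\<^sub>R \<pi> (v i))"
        | (sep) h :: "'a \<Rightarrow> real" where "linear h" "\<forall>i\<in>I. 0 \<le> h (\<pi> (v i))" "h (\<pi> c) < 0"
        using insert.IH[of "\<pi> c" "\<lambda>i. \<pi> (v i)"] by blast
      then show ?thesis
      proof cases
        case cone
        \<comment> \<open>Expanding \<open>\<pi>\<close> on both sides of the cone identity and
          collecting the multiples of \<open>v n\<close> gives this coefficient. It is nonnegative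
          because \<open>g\<close> is nonnegative on the old generators and negative at
          \<open>c\<close>.\<close>
        define w where "w = (\<Sum>i\<in>I. u i * g (v i)) - g c"
        have "w \<ge> 0"
          using cone(1) g by (simp add: w_def) (smt (verit) sum_nonneg mult_nonneg_nonneg)
        have "c = (\<Sum>i\<in>I. u i *\<^sub>R v i) + w *\<^sub>R v n"
          using cone(2) unfolding w_def \<pi>_def
          by (simp add: algebra_simps sum.distrib scaleR_sum_left)
        moreover have "(\<Sum>i\<in>I. (u(n := w)) i *\<^sub>R v i) = (\<Sum>i\<in>I. u i *\<^sub>R v i)"
          by (rule sum.cong) (use insert.hyps in auto)
        ultimately have "\<exists>u. (\<forall>i\<in>insert n I. 0 \<le> u i) \<and> c = (\<Sum>i\<in>insert n I. u i *\<^sub>R v i)"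
          using insert.hyps \<open>w \<ge> 0\<close> cone(1) by (intro exI[of _ "u(n := w)"]) auto
        then show ?thesis ..
      next
        case sep
        \<comment> \<open>Since \<open>\<pi>\<close> kills \<open>v n\<close>, pulling
          \<open>h\<close> back along \<open>\<pi>\<close> gives a functional that is nonnegative on
          the new generator as well.\<close>
        have "\<pi> (v n) = 0" by (simp add: \<pi>_def g)
        moreover have "linear (h \<circ> \<pi>)"
          using l\<pi> sep(1) by (rule linear_compose)
        ultimately have "linear (h \<circ> \<pi>) \<and> (\<forall>i\<in>insert n I. 0 \<le> (h \<circ> \<pi>) (v i)) \<and> (h \<circ> \<pi>) c < 0"
          using sep by (simp add: linear_0)
        then show ?thesis by blast
      qed
    qed
  qed
qed

text \<open>Faces are defined through open segments only; this extends the defining property to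
  finite convex combinations. The combination is either \<open>v j\<close> itself or lies strictly
  between \<open>v j\<close> and the renormalised combination of the other points.\<close>

lemma face_of_convex_sum:
  fixes v :: "'i \<Rightarrow> 'a::real_vector"
  assumes F: "F face_of C" and C: "convex C" and I: "finite I"
    and u: "\<And>i. i \<in> I \<Longrightarrow> 0 \<le> u i" "sum u I = 1"
    and v: "\<And>i. i \<in> I \<Longrightarrow> v i \<in> C"
    and y: "(\<Sum>i\<in>I. u i *\<^sub>R v i) \<in> F" and j: "j \<in> I" "0 < u j"
  shows "v j \<in> F"
proof -
  let ?J = "I - {j}"
  let ?y = "\<Sum>i\<in>I. u i *\<^sub>R v i"
  have s: "sum u I = u j + sum u ?J" and sv: "?y = u j *\<^sub>R v j + (\<Sum>i\<in>?J. u i *\<^sub>R v i)"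
    using I j by (simp_all add: sum.remove)
  have nn: "0 \<le> sum u ?J" using u by (intro sum_nonneg) auto
  show ?thesis
  proof (cases "u j = 1")
    case True
    then have "sum u ?J = 0" using s u by simp
    then have "\<forall>i\<in>?J. u i = 0"
      using I u by (subst (asm) sum_nonneg_eq_0_iff) auto
    then have "?y = v j" using sv True by simp
    then show ?thesis using y by simp
  next
    case False
    then have lt: "u j < 1" using s u nn by linarith
    define r where "r = (\<Sum>i\<in>?J. (u i / (1 - u j)) *\<^sub>R v i)"
    have "r \<in> C" unfolding r_def
    proof (rule convex_sum)
      show "(\<Sum>i\<in>?J. u i / (1 - u j)) = 1"
        using s u lt by (simp add: sum_divide_distrib[symmetric])
    qed (use I C u v lt in auto)
    have "(1 - u j) *\<^sub>R r = (\<Sum>i\<in>?J. u i *\<^sub>R v i)"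
      unfolding r_def scaleR_sum_right using lt by (intro sum.cong) auto
    then have y': "?y = (1 - u j) *\<^sub>R r + u j *\<^sub>R v j" using sv by simp
    show ?thesis
    proof (cases "r = v j")
      case True
      then have "?y = v j" using y' by (simp add: algebra_simps)
      then show ?thesis using y by simp
    next
      case False
      then have "?y \<in> open_segment r (v j)"
        using y' lt j by (auto simp: in_segment)
      then show ?thesis using face_ofD[OF F _ \<open>r \<in> C\<close> v[OF j(1)] y] by simp
    qed
  qed
qed

text \<open>A point of \<open>F\<close> is a convex combination of points of \<open>B\<close>, and
  those with positive weight lie in \<open>F\<close> by \<open>face_of_convex_sum\<close>. Hence
  inclusions between faces can be tested on generators.\<close>

lemma face_of_convex_hull_subset_convex:
  fixes B :: "'a::real_vector set"
  assumes "finite B" "F face_of convex hull B" "F \<inter> B \<subseteq> K" "convex K"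
  shows "F \<subseteq> K"
proof
  fix y assume y: "y \<in> F"
  then have "y \<in> convex hull B" using assms(2) face_of_imp_subset by blast
  then obtain u where u: "\<forall>x\<in>B. 0 \<le> u x" "sum u B = 1" "(\<Sum>x\<in>B. u x *\<^sub>R x) = y"
    using convex_hull_finite[OF assms(1)] by auto
  let ?B = "{x\<in>B. 0 < u x}"
  have sup: "?B \<subseteq> F"
  proof
    fix x assume "x \<in> ?B"
    then show "x \<in> F"
      using face_of_convex_sum[OF assms(2) convex_convex_hull assms(1), of u "\<lambda>x. x" x]
        u y hull_inc[of _ B convex] by auto
  qed
  have z: "u x = 0" if "x \<in> B - ?B" for x using u(1) that by force
  have "(\<Sum>x\<in>?B. u x *\<^sub>R x) = y"
    unfolding u(3)[symmetric] using assms(1) z by (intro sum.mono_neutral_left) auto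
  moreover have "(\<Sum>x\<in>?B. u x) = 1"
    unfolding u(2)[symmetric] using assms(1) z by (intro sum.mono_neutral_left) auto
  ultimately show "y \<in> K"
    using convex_sum[of ?B K u "\<lambda>x. x"] assms sup by auto
qed

text \<open>Farkas' lemma is applied to the lifted vectors \<open>(v i, 1)\<close>, so that affine
  functionals become linear. The zero-sum relation through \<open>j\<close> makes the constant term
  positive, which allows it to be scaled to \<open>1\<close>.\<close>

lemma face_of_convex_hull_exposed:
  fixes v :: "'i \<Rightarrow> 'a::real_vector"
  assumes I: "finite I" and F: "F face_of convex hull (v ` I)" and j: "j \<in> I" "v j \<notin> F"
    and L: "j \<in> L" "L \<subseteq> I" "(\<Sum>i\<in>L. v i) = 0"
  obtains f :: "'a \<Rightarrow> real" where "linear f" "\<And>i. i \<in> I \<Longrightarrow> 0 \<le> 1 + f (v i)"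
    "\<And>i. i \<in> I \<Longrightarrow> v i \<in> F \<Longrightarrow> 1 + f (v i) = 0" "0 < 1 + f (v j)"
proof -
  define S where "S = {i\<in>I. v i \<in> F}"
  \<comment> \<open>The \<open>Inl\<close> generators demand nonnegativity at every lifted point,
    the negated \<open>Inr\<close> generators turn this into vanishing on \<open>F\<close>, and the
    target \<open>- (v j, 1)\<close> encodes strict positivity at \<open>v j\<close>.\<close>
  let ?w = "case_sum (\<lambda>i. (v i, 1::real)) (\<lambda>i. - (v i, 1))"
  have fS: "finite S" using I by (simp add: S_def)
  consider (cone) u where "\<forall>i\<in>I <+> S. 0 \<le> u i" "- (v j, 1) = (\<Sum>i\<in>I <+> S. u i *\<^sub>R ?w i)"
    | (sep) f :: "'a \<times> real \<Rightarrow> real" where "linear f" "\<forall>i\<in>I <+> S. 0 \<le> f (?w i)" "f (- (v j, 1)) < 0"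
    using farkas[of "I <+> S" "- (v j, 1)" ?w] I fS by auto
  then show thesis
  proof cases
    case cone
    \<comment> \<open>The cone alternative is contradictory: after division by the common weight
      \<open>s\<close> it writes a point of \<open>F\<close> as a convex combination in which
      \<open>v j\<close> has positive weight, forcing \<open>v j \<in> F\<close>.\<close>
    define a b where "a = (\<lambda>i. u (Inl i))" and "b = (\<lambda>i. u (Inr i))"
    have nn: "\<And>i. i \<in> I \<Longrightarrow> 0 \<le> a i" "\<And>i. i \<in> S \<Longrightarrow> 0 \<le> b i"
      using cone(1) by (auto simp: a_def b_def)
    have eq: "- (v j, 1) = (\<Sum>i\<in>I. a i *\<^sub>R (v i, 1::real)) + (\<Sum>i\<in>S. b i *\<^sub>R (- (v i, 1)))"
      using cone(2) I fS by (simp add: sum.Plus a_def b_def comp_def)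
    have vj: "v j + (\<Sum>i\<in>I. a i *\<^sub>R v i) = (\<Sum>i\<in>S. b i *\<^sub>R v i)"
      using arg_cong[OF eq, of fst] by (simp add: fst_sum sum_negf algebra_simps)
    have s: "1 + sum a I = sum b S"
      using arg_cong[OF eq, of snd] by (simp add: snd_sum sum_negf algebra_simps)
    define s where "s = sum b S"
    have "s > 0" using s sum_nonneg[of I a] nn by (simp add: s_def)
    have q: "(\<Sum>i\<in>S. (b i / s) *\<^sub>R v i) \<in> F"
    proof (rule convex_sum)
      show "(\<Sum>i\<in>S. b i / s) = 1"
        using \<open>s > 0\<close> by (simp add: sum_divide_distrib[symmetric] s_def)
      show "convex F" using F face_of_imp_convex by blast
    qed (use fS nn \<open>s > 0\<close> in \<open>auto simp: S_def\<close>)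
    define c where "c = (\<lambda>i. ((if i = j then 1 else 0) + a i) / s)"
    have "v j \<in> F"
    proof (rule face_of_convex_sum[OF F convex_convex_hull I, of c])
      show "sum c I = 1"
        using \<open>s > 0\<close> s I j
        by (simp add: c_def s_def sum_divide_distrib[symmetric] sum.distrib)
      have "(\<Sum>i\<in>I. c i *\<^sub>R v i) = (\<Sum>i\<in>I. (1 / s) *\<^sub>R ((if i = j then v i else 0) + a i *\<^sub>R v i))"
        by (intro sum.cong) (auto simp: c_def algebra_simps add_divide_distrib)
      also have "\<dots> = (1 / s) *\<^sub>R (v j + (\<Sum>i\<in>I. a i *\<^sub>R v i))"
        using I j by (simp add: scaleR_sum_right[symmetric] sum.distrib)
      also have "\<dots> = (\<Sum>i\<in>S. (b i / s) *\<^sub>R v i)"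
        by (simp add: vj scaleR_sum_right)
      finally show "(\<Sum>i\<in>I. c i *\<^sub>R v i) \<in> F" using q by simp
      show "0 < c j" using nn(1)[OF j(1)] \<open>s > 0\<close> by (simp add: c_def)
      show "0 \<le> c i" if "i \<in> I" for i using nn(1)[OF that] \<open>s > 0\<close> by (simp add: c_def)
      show "v i \<in> convex hull v ` I" if "i \<in> I" for i using that by (simp add: hull_inc)
    qed (fact j)
    then show thesis using j by simp
  next
    case sep
    define t where "t = f (0, 1)"
    have fv: "f (x, 1) = f (x, 0) + t" for x
      using linear_add[OF sep(1), of "(x, 0)" "(0, 1)"] by (simp add: t_def)
    have neg: "f (- x) = - f x" for x using sep(1) by (rule linear_neg)
    have ge: "0 \<le> f (v i, 1)" if "i \<in> I" for i
      using sep(2) that by (metis InlI old.sum.simps(5))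
    have le: "f (v i, 1) \<le> 0" if "i \<in> S" for i
      using sep(2)[rule_format, of "Inr i"] that neg[of "(v i, 1)"] by auto
    have gt: "0 < f (v j, 1)"
      using sep(3) neg[of "(v j, 1)"] by simp
    have fL: "finite L" using I L finite_subset by blast
    have lin0: "linear (\<lambda>x. f (x, 0))"
      using linear_compose[of "\<lambda>x. (x, 0)" f] sep(1)
      by (simp add: comp_def linear_iff)
    \<comment> \<open>Summing over \<open>L\<close> cancels the linear part and leaves a multiple of
      the constant term \<open>t\<close>. The sum is positive because \<open>j\<close> contributes
      strictly and no other term is negative.\<close>
    have "(\<Sum>i\<in>L. f (v i, 1)) = f (\<Sum>i\<in>L. v i, 0) + card L * t"
      unfolding fv by (simp add: sum.distrib linear_sum[OF lin0])
    also have "\<dots> = card L * t"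
      using L sep(1) linear_0 by (simp add: zero_prod_def[symmetric] linear_0)
    finally have "card L * t = (\<Sum>i\<in>L. f (v i, 1))" by simp
    also have "\<dots> > 0"
      using L fL gt ge by (intro sum_pos2[of _ j]) auto
    finally have t: "t > 0" by (simp add: zero_less_mult_iff)
    have eq: "1 + f (x, 0) / t = f (x, 1) / t" for x using t fv[of x] by (simp add: field_simps)
    show thesis
    proof (rule that[of "\<lambda>x. f (x, 0) / t"])
      show "linear (\<lambda>x. f (x, 0) / t)"
        using lin0 unfolding linear_iff by (simp add: add_divide_distrib)
    next
      fix i assume "i \<in> I" "v i \<in> F"
      then show "1 + f (v i, 0) / t = 0"
        using le[of i] ge[of i] by (simp add: eq S_def)
    qed (use ge gt t in \<open>auto simp: eq\<close>)
  qed
qed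

text \<open>The functional keeps \<open>convex hull S\<close> in an open half-space that misses
  \<open>a\<close>.\<close>

lemma extreme_point_of_convex_hull_insert_linear:
  fixes f :: "'a::real_vector \<Rightarrow> real"
  assumes "finite S" "linear f" "\<And>x. x \<in> S \<Longrightarrow> f x < f a"
  shows "a extreme_point_of convex hull (insert a S)"
proof -
  have "convex {x. f x < f a}"
    using assms(2) convex_linear_vimage[OF assms(2), of "{..<f a}"]
    by (simp add: vimage_def)
  then have "convex hull S \<subseteq> {x. f x < f a}"
    by (intro hull_minimal) (use assms in auto)
  then show ?thesis
    by (intro extreme_point_of_convex_hull_insert) (use assms in auto)
qed

subsection \<open>Polar duality\<close>

text \<open>The point \<open>g\<close> plays the role of a relative interior point of
  \<open>G\<close>: only those inequalities are tight at \<open>g\<close> that are tight on all of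
  \<open>G\<close>. It is built by repeated midpoints, as a nonnegative functional vanishes at a
  midpoint only if it vanishes at both ends.\<close>

lemma convex_minimal_zero_set:
  fixes l :: "'i \<Rightarrow> 'b::real_vector \<Rightarrow> real"
  assumes "finite I" "convex G" "G \<noteq> {}" "\<And>i. i \<in> I \<Longrightarrow> linear (l i)"
    and "\<And>i x. i \<in> I \<Longrightarrow> x \<in> G \<Longrightarrow> 0 \<le> l i x"
  obtains g where "g \<in> G" "\<And>i x. i \<in> I \<Longrightarrow> x \<in> G \<Longrightarrow> l i g = 0 \<Longrightarrow> l i x = 0"
proof -
  have "\<exists>g\<in>G. \<forall>i\<in>I. \<forall>x\<in>G. l i g = 0 \<longrightarrow> l i x = 0"
    using assms(1,4,5)
  proof (induction I rule: finite_induct)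
    case empty
    then show ?case using assms(3) by auto
  next
    case (insert j I)
    then obtain g where g: "g \<in> G" "\<forall>i\<in>I. \<forall>x\<in>G. l i g = 0 \<longrightarrow> l i x = 0"
      by (metis insertI2)
    show ?case
    proof (cases "\<exists>x\<in>G. l j x \<noteq> 0")
      case False
      then show ?thesis using g by auto
    next
      case True
      then obtain x where x: "x \<in> G" "l j x \<noteq> 0" by blast
      let ?h = "(1/2) *\<^sub>R g + (1/2) *\<^sub>R x"
      have lh: "l i ?h = (l i g + l i x) / 2" if "i \<in> insert j I" for i
        using insert.prems(1)[OF that] by (simp add: linear_add linear_scale)
      have "l j x > 0" using insert.prems(2)[of j x] x by auto
      then have "l j ?h > 0" using insert.prems(2)[of j g] g lh[of j] by simp
      moreover have "l i y = 0" if "i \<in> I" "y \<in> G" "l i ?h = 0" for i y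
      proof -
        have "0 \<le> l i g" "0 \<le> l i x" using insert.prems(2) that(1) g(1) x(1) by auto
        then have "l i g = 0" using lh[of i] that by simp
        then show ?thesis using g that by blast
      qed
      moreover have "?h \<in> G" using g x assms(2) by (intro convexD) auto
      ultimately show ?thesis by (intro bexI[of _ ?h]) auto
    qed
  qed
  then show thesis using that by blast
qed

text \<open>Indices with \<open>b i = 0\<close> impose no condition, the others hold for all small
  positive \<open>e\<close>, and there are finitely many. This is what allows a segment to be
  prolonged slightly without violating any inequality.\<close>

lemma scale_below_pointwise:
  fixes a b :: "'i \<Rightarrow> real"
  assumes "finite I" "\<And>i. i \<in> I \<Longrightarrow> 0 \<le> b i" "\<And>i. i \<in> I \<Longrightarrow> b i = 0 \<Longrightarrow> a i = 0"
  obtains e where "0 < e" "\<And>i. i \<in> I \<Longrightarrow> e * a i \<le> b i"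
proof -
  have "\<forall>\<^sub>F e in at_right 0. \<forall>i\<in>I. e * a i \<le> b i"
  proof (rule eventually_ball_finite[OF assms(1)], rule ballI)
    fix i assume i: "i \<in> I"
    show "\<forall>\<^sub>F e in at_right 0. e * a i \<le> b i"
    proof (cases "b i = 0")
      case False
      then have "0 < b i" using assms(2)[OF i] by simp
      have "((\<lambda>e. e * a i) \<longlongrightarrow> 0 * a i) (at_right 0)" by (intro tendsto_intros)
      then have "\<forall>\<^sub>F e in at_right 0. e * a i < b i"
        using \<open>0 < b i\<close> by (intro order_tendstoD(2)) auto
      then show ?thesis by eventually_elim simp
    qed (use assms(3) i in simp)
  qed
  moreover have "\<forall>\<^sub>F e in at_right 0. (0::real) < e" by (simp add: eventually_at_right_less)
  ultimately have "\<forall>\<^sub>F e in at_right 0. 0 < e \<and> (\<forall>i\<in>I. e * a i \<le> b i)"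
    by eventually_elim simp
  then have "\<exists>e. 0 < e \<and> (\<forall>i\<in>I. e * a i \<le> b i)"
    using eventually_happens'[OF trivial_limit_at_right_real] by blast
  then show thesis using that by blast
qed

text \<open>At an interior point of a segment, a nonnegative functional is a positively weighted sum
  of its values at the ends, so it can vanish only if both values do.\<close>

lemma zero_set_face_of:
  fixes l :: "'i \<Rightarrow> 'b::real_vector \<Rightarrow> real"
  assumes "convex P" "\<And>i. i \<in> S \<Longrightarrow> linear (l i)" "\<And>i x. i \<in> S \<Longrightarrow> x \<in> P \<Longrightarrow> 0 \<le> l i x"
  shows "{x\<in>P. \<forall>i\<in>S. l i x = 0} face_of P"
  unfolding face_of_def
proof (intro conjI ballI impI)
  show "convex {x\<in>P. \<forall>i\<in>S. l i x = 0}"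
    using assms(1,2) unfolding convex_def by (auto simp: linear_add linear_scale)
next
  fix a b x assume ab: "a \<in> P" "b \<in> P" and x: "x \<in> {x\<in>P. \<forall>i\<in>S. l i x = 0}"
    and "x \<in> open_segment a b"
  then obtain u where u: "0 < u" "u < 1" "x = (1 - u) *\<^sub>R a + u *\<^sub>R b"
    by (auto simp: in_segment)
  have "l i a = 0 \<and> l i b = 0" if "i \<in> S" for i
  proof -
    have "(1 - u) * l i a + u * l i b = 0"
      using x u(3) assms(2) that by (simp add: linear_add linear_scale)
    moreover have "0 \<le> (1 - u) * l i a" "0 \<le> u * l i b"
      using ab u assms(3) that by auto
    ultimately have "(1 - u) * l i a = 0" "u * l i b = 0" by linarith+
    then show ?thesis using u by auto
  qed
  then show "a \<in> {x\<in>P. \<forall>i\<in>S. l i x = 0}" "b \<in> {x\<in>P. \<forall>i\<in>S. l i x = 0}"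
    using ab by auto
qed auto

text \<open>
  Polar duality in slack coordinates: under \<open>l i x = 1 + f (v i)\<close> the points of \<open>P\<close> are the
  linear functionals \<open>f \<ge> -1\<close> on the vertices \<open>v i\<close>. The relations \<open>sum v L = 0\<close> put \<open>0\<close> in the
  relative interior of \<open>convex hull (v ` I)\<close>.
\<close>

lemma dual_polytopes_slack:
  fixes v :: "'i \<Rightarrow> 'a::real_vector" and l :: "'i \<Rightarrow> 'b::real_vector \<Rightarrow> real"
  assumes I: "finite I" "I \<noteq> {}" and l: "\<And>i. i \<in> I \<Longrightarrow> linear (l i)"
    and relation: "\<And>j. j \<in> I \<Longrightarrow> \<exists>L\<subseteq>I. j \<in> L \<and> sum v L = 0"
    and A: "affine A"
    and functional: "\<And>x. x \<in> A \<Longrightarrow> \<exists>f::'a \<Rightarrow> real. linear f \<and> (\<forall>i\<in>I. l i x = 1 + f (v i))"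
    and point: "\<And>f::'a \<Rightarrow> real. linear f \<Longrightarrow> \<exists>x\<in>A. \<forall>i\<in>I. l i x = 1 + f (v i)"
    and P: "P = {x\<in>A. \<forall>i\<in>I. 0 \<le> l i x}"
  shows "dual_polytopes (convex hull (v ` I)) P"
proof -
  let ?C = "convex hull (v ` I)"
  define \<phi> where "\<phi> = (\<lambda>F. {x\<in>P. \<forall>i\<in>{i\<in>I. v i \<in> F}. l i x = 0})"
  have nonneg: "0 \<le> l i x" if "x \<in> P" "i \<in> I" for x i using that by (simp add: P)
  have cP: "convex P"
  proof (rule convexI)
    fix x y :: 'b and a b :: real
    assume "x \<in> P" "y \<in> P" "0 \<le> a" "0 \<le> b" "a + b = 1"
    then show "a *\<^sub>R x + b *\<^sub>R y \<in> P"
      using A l unfolding P affine_def by (auto simp: linear_add linear_scale)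
  qed
  have vC: "v i \<in> ?C" if "i \<in> I" for i using that by (simp add: hull_inc)

  have face: "\<phi> F face_of P" for F
    unfolding \<phi>_def using cP l nonneg by (intro zero_set_face_of) auto
  have anti: "\<phi> F' \<subseteq> \<phi> F" if "F \<subseteq> F'" for F F' using that by (auto simp: \<phi>_def)
  \<comment> \<open>If some \<open>v j\<close> lay in \<open>F\<close> but not in \<open>F'\<close>,
    the functional exposing \<open>F'\<close> would give a point of \<open>\<phi> F'\<close> with
    positive slack at \<open>j\<close>, hence outside \<open>\<phi> F\<close>.\<close>
  have reflect: "F \<subseteq> F'"
    if F: "F face_of ?C" and F': "F' face_of ?C" and sub: "\<phi> F' \<subseteq> \<phi> F" for F F'
  proof (rule face_of_convex_hull_subset_convex[OF _ F])
    show "F \<inter> v ` I \<subseteq> F'"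
    proof (rule ccontr)
      assume "\<not> F \<inter> v ` I \<subseteq> F'"
      then obtain j where j: "j \<in> I" "v j \<in> F" "v j \<notin> F'" by blast
      obtain L where L: "j \<in> L" "L \<subseteq> I" "sum v L = 0" using relation[OF j(1)] by blast
      obtain f :: "'a \<Rightarrow> real" where f: "linear f" "\<And>i. i \<in> I \<Longrightarrow> 0 \<le> 1 + f (v i)"
        "\<And>i. i \<in> I \<Longrightarrow> v i \<in> F' \<Longrightarrow> 1 + f (v i) = 0" "0 < 1 + f (v j)"
        using face_of_convex_hull_exposed[OF I(1) F' j(1,3) L] by blast
      obtain x where x: "x \<in> A" "\<forall>i\<in>I. l i x = 1 + f (v i)" using point[OF f(1)] by blast
      then have "x \<in> \<phi> F'" using f by (auto simp: \<phi>_def P)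
      moreover have "x \<notin> \<phi> F" using f(4) x j by (auto simp: \<phi>_def)
      ultimately show False using sub by blast
    qed
  qed (use I F' face_of_imp_convex in auto)
  have surj: "\<exists>F. F face_of ?C \<and> \<phi> F = G" if G: "G face_of P" for G
  proof (cases "G = {}")
    case True
    \<comment> \<open>The empty face is the image of the whole polytope: if all slacks vanished, the
      functional would be \<open>-1\<close> at every vertex, contradicting a zero-sum
      relation.\<close>
    have "\<phi> ?C = {}"
    proof (rule ccontr)
      assume "\<phi> ?C \<noteq> {}"
      then obtain x where x: "x \<in> A" "\<forall>i\<in>I. l i x = 0" using vC by (auto simp: \<phi>_def P)
      obtain f where f: "linear f" "\<forall>i\<in>I. l i x = 1 + f (v i)" using functional[OF x(1)] by blast
      obtain j L where L: "j \<in> L" "L \<subseteq> I" "sum v L = 0" using I relation by blast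
      have "(\<Sum>i\<in>L. f (v i)) = 0" using linear_sum[OF f(1), of v L] L linear_0[OF f(1)] by simp
      moreover have "(\<Sum>i\<in>L. f (v i)) = (\<Sum>i\<in>L. -1)"
        proof (rule sum.cong)
        show "f (v i) = -1" if "i \<in> L" for i
          using f(2) x(2) L(2) that by (metis add.commute add_eq_0_iff subsetD)
      qed simp
      ultimately have "card L = 0" by simp
      then show False using L I finite_subset by (metis card_0_eq empty_iff)
    qed
    then show ?thesis using True face_of_refl convex_convex_hull by blast
  next
    case False
    have GP: "G \<subseteq> P" "convex G" using G face_of_imp_subset face_of_imp_convex by blast+
    \<comment> \<open>The preimage of \<open>G\<close> is the face exposed by the functional of such
      a \<open>g\<close>. A vertex \<open>v i\<close> lies on it exactly when
      \<open>l i g = 0\<close>, so its image under \<open>\<phi>\<close> is cut out by the equations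
      tight at \<open>g\<close>.\<close>
    obtain g where g: "g \<in> G" "\<And>i x. i \<in> I \<Longrightarrow> x \<in> G \<Longrightarrow> l i g = 0 \<Longrightarrow> l i x = 0"
      using convex_minimal_zero_set[OF I(1) GP(2) False, of l] l nonneg GP(1) by blast
    obtain f where f: "linear f" "\<forall>i\<in>I. l i g = 1 + f (v i)"
      using functional[of g] g GP by (auto simp: P)
    define F where "F = {y\<in>?C. 1 + f y = 0}"
    have "v ` I \<subseteq> {y. -1 \<le> f y}" using f nonneg g GP by force
    moreover have "convex {y. -1 \<le> f y}"
      using convex_linear_vimage[OF f(1), of "{-1..}"] by (simp add: vimage_def)
    ultimately have fge: "?C \<subseteq> {y. -1 \<le> f y}" by (rule hull_minimal)
    have "F face_of ?C"
      unfolding face_of_def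
    proof (intro conjI ballI impI)
      have "F = ?C \<inter> f -` {-1}" by (auto simp: F_def)
      then show "convex F" using convex_linear_vimage[OF f(1), of "{-1}"] by (simp add: convex_Int)
      fix a b x assume ab: "a \<in> ?C" "b \<in> ?C" and x: "x \<in> F" and "x \<in> open_segment a b"
      then obtain u where u: "0 < u" "u < 1" "x = (1 - u) *\<^sub>R a + u *\<^sub>R b"
        by (auto simp: in_segment)
      have "(1 - u) * f a + u * f b = -1"
        using x u(3) f(1) by (simp add: F_def linear_add linear_scale)
      then have "(1 - u) * (1 + f a) + u * (1 + f b) = 0" by (simp add: algebra_simps)
      moreover have "0 \<le> (1 - u) * (1 + f a)" "0 \<le> u * (1 + f b)"
        using ab u fge by force+
      ultimately have "(1 - u) * (1 + f a) = 0" "u * (1 + f b) = 0" by linarith+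
      then show "a \<in> F" "b \<in> F" using ab u by (auto simp: F_def)
    qed (auto simp: F_def)
    have \<phi>F: "\<phi> F = {x\<in>P. \<forall>i\<in>I. l i g = 0 \<longrightarrow> l i x = 0}"
      using f vC by (auto simp: \<phi>_def F_def)
    have "\<phi> F = G"
    proof
      show "G \<subseteq> \<phi> F" using g GP by (auto simp: \<phi>F)
      show "\<phi> F \<subseteq> G"
      proof
        fix x assume "x \<in> \<phi> F"
        then have x: "x \<in> P" "\<And>i. i \<in> I \<Longrightarrow> l i g = 0 \<Longrightarrow> l i x = 0" by (auto simp: \<phi>F)
        have gP: "g \<in> P" using g GP by blast
        \<comment> \<open>The point \<open>y = g + e (g - x)\<close> continues the line from
          \<open>x\<close> slightly beyond \<open>g\<close> and stays in \<open>P\<close> for small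
          \<open>e\<close>. Then \<open>g\<close> lies between \<open>y\<close> and
          \<open>x\<close>, and the face property of \<open>G\<close> yields
          \<open>x \<in> G\<close>.\<close>
        obtain e where e: "0 < e" "\<And>i. i \<in> I \<Longrightarrow> e * l i x \<le> l i g"
          using scale_below_pointwise[OF I(1), of "\<lambda>i. l i g" "\<lambda>i. l i x"] nonneg gP x by blast
        define y where "y = (1 + e) *\<^sub>R g + (- e) *\<^sub>R x"
        have "y \<in> A"
          unfolding y_def using A gP x(1) unfolding affine_def P
          by (metis (no_types, lifting) add.assoc add.right_inverse add.right_neutral mem_Collect_eq)
        moreover have "0 \<le> l i y" if "i \<in> I" for i
        proof -
          have "l i y = l i g - e * l i x + e * l i g"
            using l[OF that] by (simp add: y_def linear_add linear_diff linear_scale linear_neg algebra_simps)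
          then show ?thesis using e that nonneg[OF gP that] by simp
        qed
        ultimately have yP: "y \<in> P" by (simp add: P)
        have "y + e *\<^sub>R x = (1 + e) *\<^sub>R g" by (simp add: y_def)
        then have "(1 / (1 + e)) *\<^sub>R (y + e *\<^sub>R x) = g" using e by simp
        moreover have "1 - e / (1 + e) = 1 / (1 + e)" using e by (simp add: field_simps)
        ultimately have geq: "g = (1 - e / (1 + e)) *\<^sub>R y + (e / (1 + e)) *\<^sub>R x"
          by (simp add: scaleR_add_right)
        show "x \<in> G"
        proof (cases "y = x")
          case True
          then have "g = x" using geq by (simp add: scaleR_left_distrib[symmetric])
          then show ?thesis using g by simp
        next
          case False
          moreover have "0 < e / (1 + e)" "e / (1 + e) < 1" using e by auto
          ultimately have "g \<in> open_segment y x"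
            unfolding in_segment using geq by blast
          then show ?thesis using face_ofD[OF G _ yP x(1) g(1)] by blast
        qed
      qed
    qed
    then show ?thesis using \<open>F face_of ?C\<close> by blast
  qed
  have "bij_betw \<phi> {F. F face_of ?C} {G. G face_of P}"
  proof (rule bij_betwI')
    show "\<phi> F = \<phi> F' \<longleftrightarrow> F = F'" if "F \<in> {F. F face_of ?C}" "F' \<in> {F. F face_of ?C}" for F F'
      using reflect[of F F'] reflect[of F' F] that by auto
    show "\<phi> F \<in> {G. G face_of P}" for F using face by simp
    show "\<exists>F\<in>{F. F face_of ?C}. G = \<phi> F" if "G \<in> {G. G face_of P}" for G
      using surj[of G] that by auto
  qed
  moreover have "F \<subseteq> F' \<longleftrightarrow> \<phi> F' \<subseteq> \<phi> F" if "F face_of ?C" "F' face_of ?C" for F F'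
    using anti[of F F'] reflect[OF that] by (rule iffI)
  ultimately show ?thesis
    unfolding dual_polytopes_def by (intro exI[of _ \<phi>] conjI allI impI)
qed

subsection \<open>The cyclotomic and transportation polytopes\<close>

lemma lookup_scaleR [simp]:
  "Poly_Mapping.lookup (r *\<^sub>R (x :: 'a \<Rightarrow>\<^sub>0 'b::real_vector)) k = r *\<^sub>R Poly_Mapping.lookup x k"
proof -
  have "finite {k. r *\<^sub>R Poly_Mapping.lookup x k \<noteq> 0}"
    by (rule finite_subset[OF _ finite_keys[of x]]) (auto simp: in_keys_iff)
  then show ?thesis by (simp add: scaleR_poly_mapping_def)
qed

lemma linear_lookup: "linear (\<lambda>x :: 'a \<Rightarrow>\<^sub>0 'b::real_vector. Poly_Mapping.lookup x k)"
  by (simp add: linear_iff lookup_add)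

section \<open>Vertices of the polytope of a single prime\<close>

text \<open>The indices \<open>j < p\<close> enumerate the vertices, so that they match the
  positions along one line of an array. The vertex that is not a basis vector takes the last index
  \<open>p - 1\<close>.\<close>

definition cyclotomic_vertex :: "nat \<Rightarrow> nat \<Rightarrow> (nat \<Rightarrow>\<^sub>0 real)" where
  "cyclotomic_vertex p j = (if j < p - 1 then unit_vec j else - (\<Sum>j<p - 1. unit_vec j))"

lemma lookup_cyclotomic_vertex:
  "Poly_Mapping.lookup (cyclotomic_vertex p j) k =
     (if j < p - 1 then of_bool (k = j) else - of_bool (k < p - 1))"
  by (auto simp: cyclotomic_vertex_def lookup_single lookup_sum when_def)

lemma sum_cyclotomic_vertex:
  assumes "0 < p"
  shows "(\<Sum>j<p. cyclotomic_vertex p j) = 0"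
proof -
  obtain q where "p = Suc q" using assms gr0_implies_Suc by blast
  then show ?thesis by (simp add: cyclotomic_vertex_def)
qed

text \<open>Each generator is separated from the others by a functional: a basis vector by its own
  coordinate, the remaining vertex by minus the coordinate sum.\<close>

lemma extreme_points_prime_cyclotomic_polytope:
  assumes "0 < p"
  shows "{v. v extreme_point_of prime_cyclotomic_polytope p} = cyclotomic_vertex p ` {..<p}"
proof -
  obtain q where p: "p = Suc q" using assms gr0_implies_Suc by blast
  let ?e = "- (\<Sum>j<q. unit_vec j)"
  have img: "cyclotomic_vertex p ` {..<p} = insert ?e (unit_vec ` {..<q})"
    by (auto simp: p lessThan_Suc cyclotomic_vertex_def)
  have hull: "prime_cyclotomic_polytope p = convex hull (insert ?e (unit_vec ` {..<q}))"
    by (simp add: prime_cyclotomic_polytope_def p)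
  have "?e extreme_point_of prime_cyclotomic_polytope p"
    unfolding hull
  proof (rule extreme_point_of_convex_hull_insert_linear)
    show "linear (\<lambda>x::nat \<Rightarrow>\<^sub>0 real. - (\<Sum>k<q. Poly_Mapping.lookup x k))"
      by (simp add: linear_iff lookup_add sum.distrib sum_distrib_left)
  qed (auto simp: lookup_sum lookup_single when_def)
  moreover have "unit_vec j extreme_point_of prime_cyclotomic_polytope p" if "j < q" for j
  proof -
    let ?S = "insert ?e (unit_vec ` ({..<q} - {j}))"
    have eq: "insert ?e (unit_vec ` {..<q}) = insert (unit_vec j) ?S" using that by auto
    show ?thesis
      unfolding hull eq
      by (rule extreme_point_of_convex_hull_insert_linear[OF _ linear_lookup[of j]])
        (use that in \<open>auto simp: lookup_sum lookup_single when_def split: if_splits\<close>)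
  qed
  ultimately show ?thesis
    unfolding img using extreme_point_of_convex_hull by (auto simp: hull)
qed

section \<open>Multi-indices and tensor products of vertices\<close>

lemma finite_multi_indices: "finite (multi_indices ns)"
proof (rule finite_subset)
  show "multi_indices ns \<subseteq> {js. set js \<subseteq> {..<sum_list ns} \<and> length js = length ns}"
  proof
    fix js assume js: "js \<in> multi_indices ns"
    have "js ! i < sum_list ns" if "i < length ns" for i
      using js that elem_le_sum_list[of i ns] by (force simp: multi_indices_def)
    then show "js \<in> {js. set js \<subseteq> {..<sum_list ns} \<and> length js = length ns}"
      using js by (auto simp: multi_indices_def in_set_conv_nth)
  qed
qed (simp add: finite_lists_length_eq)

lemma multi_indices_update:
  "js \<in> multi_indices ns \<Longrightarrow> j < ns ! i \<Longrightarrow> js[i := j] \<in> multi_indices ns"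
  by (cases "i < length js") (auto simp: multi_indices_def nth_list_update list_update_beyond)

lemma multi_indices_nonempty: "0 \<notin> set ns \<Longrightarrow> multi_indices ns \<noteq> {}"
proof -
  assume "0 \<notin> set ns"
  then have "replicate (length ns) 0 \<in> multi_indices ns"
    by (auto simp: multi_indices_def) (metis gr0I nth_mem)
  then show ?thesis by blast
qed

definition tensor_vertex :: "nat list \<Rightarrow> nat list \<Rightarrow> (nat list \<Rightarrow>\<^sub>0 real)" where
  "tensor_vertex ps js = tensor (map2 cyclotomic_vertex ps js)"

lemma lookup_tensor_vertex:
  assumes "length js = length ps"
  shows "Poly_Mapping.lookup (tensor_vertex ps js) ks =
    (if length ks = length ps
     then \<Prod>i<length ps. Poly_Mapping.lookup (cyclotomic_vertex (ps ! i) (js ! i)) (ks ! i) else 0)"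
  using assms by (auto simp: tensor_vertex_def tensor.rep_eq intro!: prod.cong)

text \<open>Choosing an index for the extreme point in each factor turns tuples of extreme points
  into multi-indices, the same index set that labels the array entries.\<close>

lemma cyclotomic_polytope_eq_hull_tensor_vertex:
  assumes "0 \<notin> set ps"
  shows "cyclotomic_polytope ps = convex hull (tensor_vertex ps ` multi_indices ps)"
proof -
  have ext: "v extreme_point_of prime_cyclotomic_polytope (ps ! i) \<longleftrightarrow>
      v \<in> cyclotomic_vertex (ps ! i) ` {..<ps ! i}" if "i < length ps" for v i
  proof -
    have "0 < ps ! i" using assms that by (metis gr0I nth_mem)
    then show ?thesis using extreme_points_prime_cyclotomic_polytope by blast
  qed
  have "{tensor vs | vs. length vs = length ps \<and>
       (\<forall>i<length ps. (vs ! i) extreme_point_of prime_cyclotomic_polytope (ps ! i))} =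
     tensor_vertex ps ` multi_indices ps" (is "?L = ?R")
  proof
    show "?L \<subseteq> ?R"
    proof clarify
      fix vs assume vs: "length vs = length ps"
        "\<forall>i<length ps. (vs ! i) extreme_point_of prime_cyclotomic_polytope (ps ! i)"
      then have "\<forall>i<length ps. \<exists>j<ps ! i. vs ! i = cyclotomic_vertex (ps ! i) j"
        using ext by blast
      then obtain j where j: "\<forall>i<length ps. j i < ps ! i \<and> vs ! i = cyclotomic_vertex (ps ! i) (j i)"
        by metis
      let ?js = "map j [0..<length ps]"
      have "vs = map2 cyclotomic_vertex ps ?js"
        using vs(1) j by (intro nth_equalityI) auto
      moreover have "?js \<in> multi_indices ps" using j by (auto simp: multi_indices_def)
      ultimately show "tensor vs \<in> ?R" unfolding tensor_vertex_def by blast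
    qed
    show "?R \<subseteq> ?L"
    proof clarify
      fix js assume "js \<in> multi_indices ps"
      then show "\<exists>vs. tensor_vertex ps js = tensor vs \<and> length vs = length ps \<and>
         (\<forall>i<length ps. (vs ! i) extreme_point_of prime_cyclotomic_polytope (ps ! i))"
        by (intro exI[of _ "map2 cyclotomic_vertex ps js"])
          (auto simp: tensor_vertex_def ext multi_indices_def)
    qed
  qed
  then show ?thesis by (simp add: cyclotomic_polytope_def)
qed

section \<open>Linear relations among the tensor vertices\<close>

text \<open>The tensor product is linear in factor \<open>i\<close>, and the vertices of that factor
  sum to zero.\<close>

lemma sum_tensor_vertex_line:
  assumes "length js = length ps" "i < length ps" "0 < ps ! i"
  shows "(\<Sum>j<ps ! i. tensor_vertex ps (js[i := j])) = 0"
proof (rule poly_mapping_eqI)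
  fix ks
  show "Poly_Mapping.lookup (\<Sum>j<ps ! i. tensor_vertex ps (js[i := j])) ks =
    Poly_Mapping.lookup 0 ks"
  proof (cases "length ks = length ps")
    case False
    then show ?thesis using assms by (simp add: lookup_sum lookup_tensor_vertex)
  next
    case True
    \<comment> \<open>The contribution of the factors other than \<open>i\<close>, which is the same
      for every \<open>j\<close>.\<close>
    define c where "c = (\<Prod>l\<in>{..<length ps} - {i}.
      Poly_Mapping.lookup (cyclotomic_vertex (ps ! l) (js ! l)) (ks ! l))"
    have "Poly_Mapping.lookup (tensor_vertex ps (js[i := j])) ks =
        Poly_Mapping.lookup (cyclotomic_vertex (ps ! i) j) (ks ! i) * c" for j
    proof -
      have "(\<Prod>l\<in>{..<length ps} - {i}.
          Poly_Mapping.lookup (cyclotomic_vertex (ps ! l) (js[i := j] ! l)) (ks ! l)) = c"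
        unfolding c_def by (rule prod.cong) auto
      then show ?thesis
        using assms True by (simp add: lookup_tensor_vertex prod.remove[of "{..<length ps}" i])
    qed
    then have "Poly_Mapping.lookup (\<Sum>j<ps ! i. tensor_vertex ps (js[i := j])) ks =
        Poly_Mapping.lookup (\<Sum>j<ps ! i. cyclotomic_vertex (ps ! i) j) (ks ! i) * c"
      by (simp add: lookup_sum sum_distrib_right)
    then show ?thesis using sum_cyclotomic_vertex[OF assms(3)] by simp
  qed
qed

text \<open>Multi-indices that avoid the last position in every direction involve basis vectors
  only. Their tensor vertices form the standard basis of the tensor space, on which a functional can
  be prescribed freely.\<close>

lemma tensor_vertex_eq_single:
  assumes "js \<in> multi_indices (map (\<lambda>p. p - 1) ps)"
  shows "tensor_vertex ps js = Poly_Mapping.single js 1"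
proof (rule poly_mapping_eqI)
  fix ks
  have js: "length js = length ps" "\<And>i. i < length ps \<Longrightarrow> js ! i < ps ! i - 1"
    using assms by (auto simp: multi_indices_def)
  have "(\<Prod>i<length ps. Poly_Mapping.lookup (cyclotomic_vertex (ps ! i) (js ! i)) (ks ! i)) =
      of_bool (\<forall>i<length ps. ks ! i = js ! i)"
    using js by (auto simp: lookup_cyclotomic_vertex)
  then show "Poly_Mapping.lookup (tensor_vertex ps js) ks =
      Poly_Mapping.lookup (Poly_Mapping.single js 1) ks"
    using js nth_equalityI[of ks js] by (cases "ks = js") (auto simp: lookup_tensor_vertex lookup_single_not_eq)
qed

text \<open>A last entry of a line is minus the sum of the others, so the entries away from the last
  positions determine the array. The induction is on the number of directions in which
  \<open>js\<close> sits at the last position.\<close>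

lemma zero_line_sums_eq_0:
  fixes h :: "nat list \<Rightarrow> real"
  assumes line: "\<And>i js. i < length ps \<Longrightarrow> js \<in> multi_indices ps \<Longrightarrow> (\<Sum>j<ps ! i. h (js[i := j])) = 0"
    and zero: "\<And>js. js \<in> multi_indices (map (\<lambda>p. p - 1) ps) \<Longrightarrow> h js = 0"
    and js: "js \<in> multi_indices ps"
  shows "h js = 0"
  using js
proof (induction "card {i. i < length ps \<and> js ! i = ps ! i - 1}" arbitrary: js rule: less_induct)
  case less
  show ?case
  proof (cases "js \<in> multi_indices (map (\<lambda>p. p - 1) ps)")
    case True
    then show ?thesis by (rule zero)
  next
    case False
    then obtain i where i: "i < length ps" "\<not> js ! i < ps ! i - 1" "js ! i < ps ! i"
      and len: "length js = length ps"
      using less.prems by (auto simp: multi_indices_def)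
    define q where "q = ps ! i - 1"
    have q: "ps ! i = Suc q" "js ! i = q" using i by (auto simp: q_def)
    have "h (js[i := j]) = 0" if "j < q" for j
    proof (rule less.hyps)
      show "js[i := j] \<in> multi_indices ps"
        using less.prems that q by (intro multi_indices_update) auto
      have "{l. l < length ps \<and> js[i := j] ! l = ps ! l - 1} \<subset>
          {l. l < length ps \<and> js ! l = ps ! l - 1}"
        (is "?A \<subset> ?B")
      proof (rule psubsetI)
        have "js[i := j] ! l = (if l = i then j else js ! l)" if "l < length ps" for l
          using that len by (simp add: nth_list_update)
        then show "?A \<subseteq> ?B" using \<open>j < q\<close> q by (auto split: if_splits)
        have "i \<in> ?B - ?A" using i(1) len q \<open>j < q\<close> by simp
        then show "?A \<noteq> ?B" by blast
      qed
      then show "card {l. l < length ps \<and> js[i := j] ! l = ps ! l - 1} <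
          card {l. l < length ps \<and> js ! l = ps ! l - 1}"
        by (intro psubset_card_mono) auto
    qed
    \<comment> \<open>All other entries of the line through \<open>js\<close> in direction
      \<open>i\<close> vanish, so its zero sum leaves only \<open>h js\<close>.\<close>
    then show ?thesis
      using line[OF i(1) less.prems] q list_update_id[of js i] by simp
  qed
qed

theorem theorem4p7:
  fixes ps :: "nat list"
  assumes "ps \<noteq> []"
    and "distinct ps"
    and "\<forall>p\<in>set ps. prime p"
  shows "dual_polytopes (cyclotomic_polytope ps) (transportation_polytope ps)"
proof -
  let ?M = "multi_indices ps"
  let ?v = "tensor_vertex ps"
  have "0 \<notin> set ps" using assms(3) not_prime_0 by blast
  then have pos: "0 < ps ! i" if "i < length ps" for i using that by (metis gr0I nth_mem)
  have len: "length js = length ps" if "js \<in> ?M" for js using that by (simp add: multi_indices_def)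
  have fline: "(\<Sum>j<ps ! i. f (?v (js[i := j]))) = 0"
    if "linear f" "i < length ps" "js \<in> ?M" for f :: "(nat list \<Rightarrow>\<^sub>0 real) \<Rightarrow> real" and i js
    using linear_sum[OF that(1), of "\<lambda>j. ?v (js[i := j])" "{..<ps ! i}"]
      sum_tensor_vertex_line[OF len[OF that(3)] that(2) pos[OF that(2)]] linear_0[OF that(1)] by simp
  \<comment> \<open>The affine space of the line-sum equations, without the sign conditions.\<close>
  define A where "A = {x::nat list \<Rightarrow>\<^sub>0 real. Poly_Mapping.keys x \<subseteq> ?M \<and>
    (\<forall>i<length ps. \<forall>js\<in>?M. (\<Sum>j<ps ! i. Poly_Mapping.lookup x (js[i := j])) = real (ps ! i))}"
  have "dual_polytopes (convex hull (?v ` ?M)) (transportation_polytope ps)"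
  proof (rule dual_polytopes_slack[where l = "\<lambda>js x. Poly_Mapping.lookup x js" and A = A])
    show "finite ?M" by (rule finite_multi_indices)
    show "?M \<noteq> {}" using \<open>0 \<notin> set ps\<close> by (rule multi_indices_nonempty)
    show "linear (\<lambda>x. Poly_Mapping.lookup x js)" for js :: "nat list" by (rule linear_lookup)
    show "transportation_polytope ps = {x\<in>A. \<forall>js\<in>?M. 0 \<le> Poly_Mapping.lookup x js}"
      by (auto simp: transportation_polytope_def A_def)
  next
    fix js assume js: "js \<in> ?M"
    \<comment> \<open>The relation through \<open>js\<close> is its line in direction
      \<open>0\<close>, a direction that exists because \<open>ps\<close> is nonempty.\<close>
    let ?L = "(\<lambda>j. js[0 := j]) ` {..<ps ! 0}"
    have ne: "0 < length ps" "0 < length js" using assms(1) len[OF js] by auto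
    have "inj_on (\<lambda>j. js[0 := j]) {..<ps ! 0}"
      using ne by (metis inj_onI nth_list_update_eq)
    then have "sum ?v ?L = 0"
      using sum_tensor_vertex_line[OF len[OF js] ne(1) pos[OF ne(1)]] by (simp add: sum.reindex)
    moreover have "js[0 := js ! 0] \<in> ?L"
      using js ne by (intro imageI) (auto simp: multi_indices_def)
    moreover have "?L \<subseteq> ?M" using js by (auto intro: multi_indices_update)
    ultimately show "\<exists>L\<subseteq>?M. js \<in> L \<and> sum ?v L = 0" by (metis list_update_id)
  next
    show "affine A"
      unfolding affine_def
    proof (intro ballI allI impI)
      fix x y and a b :: real assume xy: "x \<in> A" "y \<in> A" and ab: "a + b = 1"
      have "Poly_Mapping.keys (a *\<^sub>R x + b *\<^sub>R y) \<subseteq> ?M"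
      proof
        fix js assume "js \<in> Poly_Mapping.keys (a *\<^sub>R x + b *\<^sub>R y)"
        then have "js \<in> Poly_Mapping.keys x \<union> Poly_Mapping.keys y"
          by (auto simp: in_keys_iff lookup_add)
        then show "js \<in> ?M" using xy by (auto simp: A_def)
      qed
      moreover have "(\<Sum>j<ps ! i. Poly_Mapping.lookup (a *\<^sub>R x + b *\<^sub>R y) (js[i := j])) = real (ps ! i)"
        if "i < length ps" "js \<in> ?M" for i js
      proof -
        have "(\<Sum>j<ps ! i. Poly_Mapping.lookup (a *\<^sub>R x + b *\<^sub>R y) (js[i := j])) =
            a * (\<Sum>j<ps ! i. Poly_Mapping.lookup x (js[i := j])) +
            b * (\<Sum>j<ps ! i. Poly_Mapping.lookup y (js[i := j]))"
          by (simp add: lookup_add sum.distrib sum_distrib_left)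
        also have "\<dots> = (a + b) * real (ps ! i)"
          using xy that by (simp add: A_def algebra_simps)
        finally show ?thesis using ab by simp
      qed
      ultimately show "a *\<^sub>R x + b *\<^sub>R y \<in> A" by (simp add: A_def)
    qed
  next
    fix x assume x: "x \<in> A"
    let ?M' = "multi_indices (map (\<lambda>p. p - 1) ps)"
    \<comment> \<open>On the standard basis \<open>f\<close> takes the values of
      \<open>x - 1\<close>. The difference between \<open>x - 1\<close> and \<open>f\<close> at the
      tensor vertices has zero line sums, hence vanishes on all of \<open>?M\<close> once it
      vanishes on \<open>?M'\<close>.\<close>
    define f :: "(nat list \<Rightarrow>\<^sub>0 real) \<Rightarrow> real" where
      "f = (\<lambda>z. \<Sum>ks\<in>?M'. (Poly_Mapping.lookup x ks - 1) * Poly_Mapping.lookup z ks)"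
    have f: "linear f"
      unfolding f_def linear_iff
      by (simp add: lookup_add sum.distrib algebra_simps sum_distrib_left sum_subtractf)
    have "Poly_Mapping.lookup x js - 1 - f (?v js) = 0" if "js \<in> ?M" for js
    proof (rule zero_line_sums_eq_0[OF _ _ that])
      show "(\<Sum>j<ps ! i. Poly_Mapping.lookup x (js[i := j]) - 1 - f (?v (js[i := j]))) = 0"
        if "i < length ps" "js \<in> ?M" for i js
        using x that fline[OF f that] by (simp add: sum_subtractf A_def)
      show "Poly_Mapping.lookup x js - 1 - f (?v js) = 0" if "js \<in> ?M'" for js
      proof -
        have "f (?v js) = (\<Sum>ks\<in>?M'. if ks = js then Poly_Mapping.lookup x ks - 1 else 0)"
          unfolding f_def tensor_vertex_eq_single[OF that]
          by (rule sum.cong) (auto simp: lookup_single when_def)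
        then show ?thesis using that by (simp add: finite_multi_indices)
      qed
    qed
    then show "\<exists>f. linear f \<and> (\<forall>js\<in>?M. Poly_Mapping.lookup x js = 1 + f (?v js))"
      using f by (intro exI[of _ f]) (auto simp: algebra_simps)
  next
    fix f :: "(nat list \<Rightarrow>\<^sub>0 real) \<Rightarrow> real" assume f: "linear f"
    \<comment> \<open>The ones contribute exactly \<open>ps ! i\<close> to each line in direction
      \<open>i\<close> and the values of \<open>f\<close> contribute zero; the default
      \<open>0\<close> outside \<open>?M\<close> keeps the support inside the array.\<close>
    define x where "x = Abs_poly_mapping (\<lambda>js. if js \<in> ?M then 1 + f (?v js) else 0)"
    have "finite {js. (if js \<in> ?M then 1 + f (?v js) else 0) \<noteq> 0}"
      by (rule finite_subset[OF _ finite_multi_indices[of ps]]) auto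
    then have x: "Poly_Mapping.lookup x = (\<lambda>js. if js \<in> ?M then 1 + f (?v js) else 0)"
      by (simp add: x_def)
    have "(\<Sum>j<ps ! i. Poly_Mapping.lookup x (js[i := j])) = real (ps ! i)"
      if "i < length ps" "js \<in> ?M" for i js
    proof -
      have "(\<Sum>j<ps ! i. Poly_Mapping.lookup x (js[i := j])) = (\<Sum>j<ps ! i. 1 + f (?v (js[i := j])))"
        using that by (intro sum.cong) (auto simp: x multi_indices_update)
      then show ?thesis using fline[OF f that] by (simp add: sum.distrib)
    qed
    then have "x \<in> A" by (auto simp: A_def in_keys_iff x split: if_splits)
    then show "\<exists>x\<in>A. \<forall>js\<in>?M. Poly_Mapping.lookup x js = 1 + f (?v js)"
      by (intro bexI[of _ x]) (auto simp: x)
  qed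
  then show ?thesis
    by (simp add: cyclotomic_polytope_eq_hull_tensor_vertex[OF \<open>0 \<notin> set ps\<close>])
qed

end
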